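(* Let $J$ be a free ideal on a set $S$ with $S\notin\langle J\rangle$, and let $k$ be a positive integer. If there is a cofinal family $\mathcal{A}\subset\langle J\rangle$ such that TWO has a winning $k$-tactic in $MG(\mathcal{A},J)$, then TWO has a winning $2$-tactic in $VSG(J)$.
   Context: The symbol $\subset$ between elements of $\langle J\rangle$ always means "is a proper subset of". A free ideal $J$ on $S$ is an ideal of subsets of $S$ with $\bigcup J=S$; $\langle J\rangle$ is the $\sigma$-completion of $J$, i.e. the collection of all unions of countably many members of $J$. A family $\mathcal{A}$ of elements of $\langle J\rangle$ is cofinal if every element of $\langle J\rangle$ is contained in an element of $\mathcal{A}$ ($\mathcal{A}=\langle J\rangle$ is allowed). Game $MG(\mathcal{A},J)$: in inning $n$ ($n=1,2,\dots$) ONE plays $O_n\in\mathcal{A}$ and TWO responds with $T_n\in J$; ONE must satisfy $O_n\subset O_{n+1}$ for all $n$. TWO wins if $\bigcup_n O_n\subseteq\bigcup_n T_n$. Game $VSG(J)$: in inning $n$ ONE plays $O_n\in\langle J\rangle$ and TWO responds with a pair $(T_n,S_n)\in J\times\langle J\rangle$; ONE must satisfy $O_n\cup T_n\cup S_n\subseteq O_{n+1}$ for all $n$. TWO wins if $\bigcup_n O_n=\bigcup_n T_n$. A $k$-tactic for TWO is a function $F$ assigning a legal response of TWO to each sequence of length at most $k$ (and at least $1$) of possible successive moves of ONE; it is winning if TWO wins every play in which TWO's $j$-th response is $F(O_1,\dots,O_j)$ for $j\le k$ and TWO's $(n+k)$-th response is $F(O_{n+1},\dots,O_{n+k})$ for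 all $n\ge 1$. *)

theory Defs
  imports Main "HOL-Library.Countable_Set"
begin

definition free_ideal :: "'a set \<Rightarrow> 'a set set \<Rightarrow> bool" where
  "free_ideal S J \<longleftrightarrow>
     {} \<in> J \<and>
     (\<forall>X\<in>J. \<forall>Y. Y \<subseteq> X \<longrightarrow> Y \<in> J) \<and>
     (\<forall>X\<in>J. \<forall>Y\<in>J. X \<union> Y \<in> J) \<and>
     \<Union>J = S"

definition sigma_completion :: "'a set set \<Rightarrow> 'a set set" where
  "sigma_completion J = {\<Union>C | C. C \<subseteq> J \<and> countable C}"

definition cofinal_family :: "'a set set \<Rightarrow> 'a set set \<Rightarrow> bool" where
  "cofinal_family A J \<longleftrightarrow>
     A \<subseteq> sigma_completion J \<and> (\<forall>X\<in>sigma_completion J. \<exists>Y\<in>A. X \<subseteq> Y)"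

text \<open>Games of length omega in which the legality of a move of ONE depends only on the preceding
  inning: \<open>may_follow G x t y\<close> says that ONE may play \<open>y\<close> in the inning after one in which ONE
  played \<open>x\<close> and TWO answered \<open>t\<close>. Innings are numbered from 0, so that \<open>x n\<close> and \<open>t n\<close> are the
  moves of inning \<open>n + 1\<close> in the numbering that starts at 1.\<close>

record ('o, 't) game =
  one_moves :: "'o set"
  two_moves :: "'t set"
  may_follow :: "'o \<Rightarrow> 't \<Rightarrow> 'o \<Rightarrow> bool"
  two_wins :: "(nat \<Rightarrow> 'o) \<Rightarrow> (nat \<Rightarrow> 't) \<Rightarrow> bool"

definition MG :: "'a set set \<Rightarrow> 'a set set \<Rightarrow> ('a set, 'a set) game" where
  "MG A J =
     \<lparr>one_moves = A,
      two_moves = J,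
      may_follow = (\<lambda>X T Y. X \<subset> Y),
      two_wins = (\<lambda>X T. (\<Union>n. X n) \<subseteq> (\<Union>n. T n))\<rparr>"

definition VSG :: "'a set set \<Rightarrow> ('a set, 'a set \<times> 'a set) game" where
  "VSG J =
     \<lparr>one_moves = sigma_completion J,
      two_moves = J \<times> sigma_completion J,
      may_follow = (\<lambda>X (T, U) Y. X \<union> T \<union> U \<subseteq> Y),
      two_wins = (\<lambda>X R. (\<Union>n. X n) = (\<Union>n. fst (R n)))\<rparr>"

text \<open>Lists of moves that ONE can make in consecutive innings against some legal answers of TWO,
  which need not come from any particular strategy.\<close>

definition successive_moves :: "('o, 't) game \<Rightarrow> 'o list \<Rightarrow> bool" where
  "successive_moves G xs \<longleftrightarrow>
     set xs \<subseteq> one_moves G \<and>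
     (\<exists>ts. length ts = length xs \<and> set ts \<subseteq> two_moves G \<and>
       (\<forall>i. Suc i < length xs \<longrightarrow> may_follow G (xs ! i) (ts ! i) (xs ! Suc i)))"

definition k_tactic :: "('o, 't) game \<Rightarrow> nat \<Rightarrow> ('o list \<Rightarrow> 't) \<Rightarrow> bool" where
  "k_tactic G k F \<longleftrightarrow>
     (\<forall>xs. 1 \<le> length xs \<and> length xs \<le> k \<and> successive_moves G xs \<longrightarrow> F xs \<in> two_moves G)"

text \<open>The answer given by \<open>F\<close> in inning \<open>n\<close>. As subtraction on \<^typ>\<open>nat\<close> is truncated, the list
  consists of all moves \<open>x 0, \<dots>, x n\<close> if \<open>n < k\<close>, and of the last \<open>k\<close> of them otherwise.\<close>

definition tactic_response :: "nat \<Rightarrow> ('o list \<Rightarrow> 't) \<Rightarrow> (nat \<Rightarrow> 'o) \<Rightarrow> nat \<Rightarrow> 't" where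
  "tactic_response k F x n = F (map x [Suc n - k..<Suc n])"

definition winning_k_tactic :: "('o, 't) game \<Rightarrow> nat \<Rightarrow> ('o list \<Rightarrow> 't) \<Rightarrow> bool" where
  "winning_k_tactic G k F \<longleftrightarrow>
     k_tactic G k F \<and>
     (\<forall>x. (\<forall>n. x n \<in> one_moves G) \<and>
          (\<forall>n. may_follow G (x n) (tactic_response k F x n) (x (Suc n)))
        \<longrightarrow> two_wins G x (tactic_response k F x))"

end

(* In VSG, TWO answers O with a set U that is the top of a strictly increasing chain of k members of
   the cofinal family lying strictly above O. As ONE has to include U in the next move, the chains
   belonging to consecutive moves of ONE line up to a play of ONE in MG, in which the last k moves
   up to any position within the current chain belong to the current chain or the previous one.
   Hence the last two moves of ONE in VSG determine what the k-tactic answers along the current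
   chain, and TWO plays the union of these k answers. *)

theory Submission
  imports Defs
begin

lemma sigma_completion_Un:
  assumes "X \<in> sigma_completion J" "Y \<in> sigma_completion J"
  shows "X \<union> Y \<in> sigma_completion J"
proof -
  obtain C D where "X = \<Union>C" "C \<subseteq> J" "countable C" "Y = \<Union>D" "D \<subseteq> J" "countable D"
    using assms unfolding sigma_completion_def by blast
  then have "X \<union> Y = \<Union>(C \<union> D)" "C \<union> D \<subseteq> J" "countable (C \<union> D)"
    by auto
  then show ?thesis
    unfolding sigma_completion_def by blast
qed

lemma ideal_subset_sigma_completion: "J \<subseteq> sigma_completion J"
proof
  fix X assume "X \<in> J"
  then have "X = \<Union>{X}" "{X} \<subseteq> J" "countable {X}"
    by auto
  then show "X \<in> sigma_completion J"
    unfolding sigma_completion_def by blast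
qed

lemma free_ideal_UN:
  assumes "free_ideal S J" "finite I" "\<And>i. i \<in> I \<Longrightarrow> f i \<in> J"
  shows "(\<Union>i\<in>I. f i) \<in> J"
  using assms(2,3)
proof (induction I rule: finite_induct)
  case empty
  then show ?case
    using assms(1) by (simp add: free_ideal_def)
next
  case (insert i I)
  then have "f i \<in> J" "(\<Union>i\<in>I. f i) \<in> J"
    by simp_all
  then show ?case
    using assms(1) by (simp add: free_ideal_def)
qed

text \<open>As \<open>S\<close> is not in \<open>sigma_completion J\<close>, some point
  \<open>s\<close> of \<open>S\<close> lies outside \<open>X\<close>. Adjoining to \<open>X\<close>
  a member of \<open>J\<close> that contains \<open>s\<close> makes the inclusion strict.\<close>

lemma cofinal_family_psubset:
  assumes "free_ideal S J" "S \<notin> sigma_completion J" "cofinal_family A J"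
    and X: "X \<in> sigma_completion J"
  shows "\<exists>Y\<in>A. X \<subset> Y"
proof -
  have "X \<subseteq> S"
    using X assms(1) by (auto simp: sigma_completion_def free_ideal_def)
  then obtain s where s: "s \<in> S" "s \<notin> X"
    using X assms(2) by (metis subsetI subset_antisym)
  then obtain Z where "Z \<in> J" "s \<in> Z"
    using assms(1) by (auto simp: free_ideal_def)
  then have "X \<union> Z \<in> sigma_completion J"
    using sigma_completion_Un X ideal_subset_sigma_completion by blast
  then obtain Y where "Y \<in> A" "X \<union> Z \<subseteq> Y"
    using assms(3) by (auto simp: cofinal_family_def)
  with s \<open>s \<in> Z\<close> show ?thesis
    by blast
qed

lemma tactic_response_shift:
  assumes "\<And>m. m \<le> n \<Longrightarrow> y m = x (m + d)" "d = 0 \<or> k \<le> Suc n"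
  shows "tactic_response k F y n = tactic_response k F x (n + d)"
proof -
  have "map y [Suc n - k..<Suc n] = map (\<lambda>m. x (m + d)) [Suc n - k..<Suc n]"
    using assms(1) by (intro map_cong) auto
  also have "\<dots> = map x (map (\<lambda>m. m + d) [Suc n - k..<Suc n])"
    by (simp add: comp_def)
  also have "map (\<lambda>m. m + d) [Suc n - k..<Suc n] = [Suc n - k + d..<Suc n + d]"
    by (rule nth_equalityI) (simp_all del: upt_Suc)
  also have "\<dots> = [Suc (n + d) - k..<Suc (n + d)]"
    using assms(2) by (auto intro: arg_cong2[where f = upt])
  finally show ?thesis
    by (simp only: tactic_response_def)
qed

lemma tactic_response_MG_in_ideal:
  assumes "k_tactic (MG A J) k F" "k \<ge> 1" "J \<noteq> {}"
    and "\<And>m. x m \<in> A" "\<And>m. x m \<subset> x (Suc m)"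
  shows "tactic_response k F x n \<in> J"
proof -
  let ?xs = "map x [Suc n - k..<Suc n]"
  obtain T where T: "T \<in> J"
    using assms(3) by blast
  have "\<forall>i. Suc i < length ?xs \<longrightarrow> ?xs ! i \<subset> ?xs ! Suc i"
    using assms(5) by (simp del: upt_Suc)
  \<comment> \<open>ONE's rule in MG ignores the answers of TWO, so a constant list of answers is a
    witness.\<close>
  moreover have "length (replicate (length ?xs) T) = length ?xs"
      "set (replicate (length ?xs) T) \<subseteq> J"
    using T by auto
  moreover have "set ?xs \<subseteq> A"
    using assms(4) by auto
  ultimately have "successive_moves (MG A J) ?xs"
    unfolding successive_moves_def MG_def game.simps by blast
  moreover have "1 \<le> length ?xs" "length ?xs \<le> k"
    using assms(2) by auto
  ultimately show ?thesis
    using assms(1) unfolding k_tactic_def tactic_response_def by (auto simp: MG_def)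
qed

text \<open>Block \<open>n\<close> consists of \<open>k\<close> entries above \<open>x n\<close>.
  The exponent starts at 1, so each entry is a value of \<open>up\<close> and thus can lie in
  \<open>A\<close> even if \<open>x n\<close> does not; the block ends with
  \<open>(up ^^ k) (x n)\<close>.\<close>

definition interpolated_play :: "nat \<Rightarrow> ('o \<Rightarrow> 'o) \<Rightarrow> (nat \<Rightarrow> 'o) \<Rightarrow> nat \<Rightarrow> 'o" where
  "interpolated_play k up x m = (up ^^ Suc (m mod k)) (x (m div k))"

definition block_response ::
    "nat \<Rightarrow> ('a set list \<Rightarrow> 'a set) \<Rightarrow> (nat \<Rightarrow> 'a set) \<Rightarrow> nat \<Rightarrow> 'a set" where
  "block_response k F z n = (\<Union>i<k. tactic_response k F z (n * k + i))"

(* TWO's tactic must answer legally even on lists that cannot arise from following it, where the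
   chains may fail to line up and the set computed from F need not be in J: hence the test. The
   second component is outside the test, so it forces the chains to line up unconditionally. *)
definition interpolating_tactic ::
    "'a set set \<Rightarrow> nat \<Rightarrow> ('a set \<Rightarrow> 'a set) \<Rightarrow> ('a set list \<Rightarrow> 'a set) \<Rightarrow>
     'a set list \<Rightarrow> 'a set \<times> 'a set" where
  "interpolating_tactic J k up F xs =
     (let T = block_response k F (interpolated_play k up ((!) xs)) (length xs - 1)
      in (if T \<in> J then T else {}, (up ^^ k) (last xs)))"

text \<open>Inside a block each entry is \<open>up\<close> of the one before. At the end of a block
  the last entry is contained in the next \<open>x n\<close>, which \<open>up\<close> enlarges
  strictly.\<close>

lemma interpolated_play_increasing:
  assumes "k \<ge> 1" "\<And>X. X \<in> M \<Longrightarrow> up X \<in> M \<and> X \<subset> up X" "\<And>n. x n \<in> M"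
    and "\<And>n. (up ^^ k) (x n) \<subseteq> x (Suc n)"
  shows "interpolated_play k up x m \<subset> interpolated_play k up x (Suc m)"
proof (cases "Suc (m mod k) = k")
  case True
  then have "Suc m mod k = 0" "Suc m div k = Suc (m div k)"
    by (simp_all add: mod_Suc div_Suc)
  then have "interpolated_play k up x (Suc m) = up (x (Suc (m div k)))"
    by (simp add: interpolated_play_def)
  moreover have "interpolated_play k up x m \<subseteq> x (Suc (m div k))"
    using True assms(4) by (simp add: interpolated_play_def del: funpow.simps)
  moreover have "x (Suc (m div k)) \<subset> up (x (Suc (m div k)))"
    using assms(2,3) by blast
  ultimately show ?thesis
    by simp
next
  case False
  then have "Suc m mod k = Suc (m mod k)" "Suc m div k = m div k"
    by (simp_all add: mod_Suc div_Suc)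
  then have "interpolated_play k up x (Suc m) = up (interpolated_play k up x m)"
    by (simp add: interpolated_play_def)
  moreover have "(up ^^ i) (x n) \<in> M" for i n
    by (induction i) (use assms(2,3) in auto)
  ultimately show ?thesis
    using assms(2) unfolding interpolated_play_def by metis
qed

lemma interpolated_play_covers:
  assumes "k \<ge> 1" "x n \<subset> up (x n)"
  shows "x n \<subseteq> interpolated_play k up x (n * k)"
  using assms by (auto simp: interpolated_play_def)

text \<open>Dropping \<open>d\<close> moves drops \<open>d * k\<close> entries of the interpolated
  play. If \<open>d > 0\<close>, a full block of \<open>k\<close> entries still precedes the current
  one, so no window of length \<open>k\<close> reaches the dropped entries. This is why two moves
  suffice.\<close>

lemma block_response_shift:
  assumes "k \<ge> 1" "d \<le> n" "d = 0 \<or> d < n" "\<And>j. j \<le> n - d \<Longrightarrow> y j = x (j + d)"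
  shows "block_response k F (interpolated_play k up y) (n - d) =
         block_response k F (interpolated_play k up x) n"
proof -
  have "tactic_response k F (interpolated_play k up y) ((n - d) * k + i) =
        tactic_response k F (interpolated_play k up x) (n * k + i)" if "i < k" for i
  proof -
    have "interpolated_play k up y m = interpolated_play k up x (m + d * k)"
      if "m \<le> (n - d) * k + i" for m
    proof -
      have "m div k \<le> ((n - d) * k + i) div k"
        using that by (rule div_le_mono)
      also have "\<dots> = n - d"
        using \<open>i < k\<close> by simp
      finally show ?thesis
        using assms(1,4) by (simp add: interpolated_play_def add.commute)
    qed
    moreover have "d * k = 0 \<or> k \<le> Suc ((n - d) * k + i)"
    proof (cases "d = 0")
      case False
      then have "1 * k \<le> (n - d) * k"
        using assms(3) by (intro mult_le_mono1) simp
      then show ?thesis by linarith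
    qed simp
    ultimately have "tactic_response k F (interpolated_play k up y) ((n - d) * k + i) =
        tactic_response k F (interpolated_play k up x) ((n - d) * k + i + d * k)"
      by (rule tactic_response_shift)
    moreover have "(n - d) * k + i + d * k = n * k + i"
      using mult_le_mono1[OF assms(2), of k] unfolding diff_mult_distrib by linarith
    ultimately show ?thesis
      by simp
  qed
  then show ?thesis
    unfolding block_response_def by simp
qed

lemma tactic_response_interpolating_tactic:
  fixes x :: "nat \<Rightarrow> 'a set" and up :: "'a set \<Rightarrow> 'a set" and F :: "'a set list \<Rightarrow> 'a set"
  assumes "k \<ge> 1"
  defines "T n \<equiv> block_response k F (interpolated_play k up x) n"
  shows "tactic_response 2 (interpolating_tactic J k up F) x n =
         (if T n \<in> J then T n else {}, (up ^^ k) (x n))"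
proof -
  \<comment> \<open>The list that TWO sees starts at index \<open>d\<close>, which is 0 for
    \<open>n \<le> 1\<close> and \<open>n - 1\<close> otherwise.\<close>
  define d where "d = Suc n - 2"
  let ?xs = "map x [d..<Suc n]"
  \<comment> \<open>Only indices up to \<open>n - d\<close> are read, so the values of
    \<open>(!)\<close> past the end of the list do not matter.\<close>
  have "block_response k F (interpolated_play k up ((!) ?xs)) (n - d) = T n"
    unfolding T_def
  proof (rule block_response_shift)
    show "?xs ! j = x (j + d)" if "j \<le> n - d" for j
    proof -
      have "j < Suc n - d"
        using that by (simp add: d_def)
      then show ?thesis
        by (simp add: add.commute del: upt_Suc)
    qed
  qed (use assms(1) in \<open>auto simp: d_def\<close>)
  moreover have "length ?xs - 1 = n - d" "last ?xs = x n"
    by (auto simp: d_def)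
  ultimately show ?thesis
    unfolding tactic_response_def interpolating_tactic_def Let_def
    by (simp only: flip: d_def)
qed

theorem proposition33:
  fixes S :: "'a set" and J :: "'a set set" and k :: nat
  assumes "free_ideal S J"
    and "S \<notin> sigma_completion J"
    and "k \<ge> 1"
    and "\<exists>A. cofinal_family A J \<and> (\<exists>F. winning_k_tactic (MG A J) k F)"
  shows "\<exists>G. winning_k_tactic (VSG J) 2 G"
proof -
  obtain A F where A: "cofinal_family A J" and F: "winning_k_tactic (MG A J) k F"
    using assms(4) by blast
  let ?M = "sigma_completion J"
  \<comment> \<open>A choice function on \<open>sigma_completion J\<close>; as its values lie in
    \<open>A\<close>, which is contained in this domain, it can be iterated.\<close>
  obtain up where up: "\<And>X. X \<in> ?M \<Longrightarrow> up X \<in> A \<and> X \<subset> up X"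
    using cofinal_family_psubset[OF assms(1,2) A] by metis
  have AM: "A \<subseteq> ?M"
    using A by (simp add: cofinal_family_def)
  have up_M: "up X \<in> ?M \<and> X \<subset> up X" if "X \<in> ?M" for X
    using up[OF that] AM by blast
  have pow_M: "(up ^^ i) X \<in> ?M" if "X \<in> ?M" for i X
    by (induction i) (use that up_M in auto)
  have J: "{} \<in> J"
    using assms(1) by (simp add: free_ideal_def)
  let ?G = "interpolating_tactic J k up F"
  have "winning_k_tactic (VSG J) 2 ?G"
    unfolding winning_k_tactic_def
  proof (intro conjI allI impI, goal_cases)
    case 1
    show ?case
      unfolding k_tactic_def
    proof (intro allI impI)
      fix xs assume "1 \<le> length xs \<and> length xs \<le> 2 \<and> successive_moves (VSG J) xs"
      then have "last xs \<in> ?M"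
        using last_in_set[of xs] by (fastforce simp: successive_moves_def VSG_def)
      then show "?G xs \<in> two_moves (VSG J)"
        using J pow_M by (simp add: VSG_def interpolating_tactic_def Let_def)
    qed
  next
    case (2 x)
    then have x_M: "x n \<in> ?M"
        and x_step: "x n \<union> fst (tactic_response 2 ?G x n) \<union> snd (tactic_response 2 ?G x n)
            \<subseteq> x (Suc n)" for n
      by (simp_all add: VSG_def split_beta)
    define z where "z = interpolated_play k up x"
    let ?T = "block_response k F z"
    note resp = tactic_response_interpolating_tactic[OF assms(3)]
    have step_up: "(up ^^ k) (x n) \<subseteq> x (Suc n)" for n
      using x_step[of n] by (simp add: resp)
    have z_inc: "z m \<subset> z (Suc m)" for m
      unfolding z_def using assms(3) up_M x_M step_up by (rule interpolated_play_increasing)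
    have z_A: "z m \<in> A" for m
      using up[OF pow_M[OF x_M]] by (simp add: z_def interpolated_play_def)
    have "tactic_response k F z m \<in> J" for m
      using F J z_A z_inc assms(3)
      by (intro tactic_response_MG_in_ideal) (auto simp: winning_k_tactic_def)
    then have T_J: "?T n \<in> J" for n
      unfolding block_response_def by (intro free_ideal_UN[OF assms(1)]) simp_all
    \<comment> \<open>By \<open>T_J\<close> the membership test succeeds in every inning of an
      actual play, so the fallback \<open>{}\<close> is never taken.\<close>
    have T_resp: "fst (tactic_response 2 ?G x n) = ?T n" for n
      using T_J[of n] by (simp add: resp z_def)
    have "two_wins (MG A J) z (tactic_response k F z)"
      using F z_A z_inc unfolding winning_k_tactic_def by (simp add: MG_def)
    then have z_covered: "(\<Union>m. z m) \<subseteq> (\<Union>m. tactic_response k F z m)"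
      by (simp add: MG_def)
    have "tactic_response k F z m \<subseteq> ?T (m div k)" for m
    proof -
      have "tactic_response k F z (m div k * k + m mod k) \<subseteq> ?T (m div k)"
        unfolding block_response_def using assms(3) by (intro UN_upper) simp
      then show ?thesis
        by simp
    qed
    then have T_covers: "(\<Union>m. tactic_response k F z m) \<subseteq> (\<Union>n. ?T n)"
      by (intro UN_least SUP_upper2[OF UNIV_I])
    have x_z: "x n \<subseteq> z (n * k)" for n
      unfolding z_def using assms(3) up_M[OF x_M]
      by (intro interpolated_play_covers) simp_all
    \<comment> \<open>One inclusion comes from the win in MG, since \<open>z\<close> dominates the
      moves of ONE. The other holds in any legal play, as ONE's next move must contain TWO's
      answer.\<close>
    have "(\<Union>n. x n) = (\<Union>n. ?T n)"
    proof (intro subset_antisym UN_least)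
      show "x n \<subseteq> (\<Union>n. ?T n)" for n
        using x_z[of n] z_covered T_covers by (meson UNIV_I UN_upper order_trans)
      show "?T n \<subseteq> (\<Union>n. x n)" for n
        using x_step[of n] T_resp[of n] by (intro SUP_upper2[of "Suc n"]) simp_all
    qed
    then show ?case
      by (simp add: VSG_def T_resp)
  qed
  then show ?thesis
    by blast
qed

end
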